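(* For all integers $n,p,m\geq0$, \[ B_{n+m,p}=(p+1)\sum_{k=0}^{m}\left\{{m+p\atop k+p}\right\}_{p}\frac{(-1)^{k}(p+1)_{k}}{k+p+1}\,B_{n,p+k}. \] For all integers $n,r\geq1$ and $p\geq0$, \[ B_{n,p+r}=\frac{r(p+r+1)}{(r+1)(r)_{p+1}}\sum_{k=0}^{p}\left[{p+r\atop k+r}\right]_{r}(-1)^{k}B_{n+k,r}. \]
   Context: The $p$-Bernoulli numbers $B_{n,p}$ are defined by $\sum_{n\ge0}B_{n,p}\frac{t^{n}}{n!}={}_{2}F_{1}(1,1;p+2;1-e^{t})$, where ${}_2F_1(a,b;c;z)=\sum_{k\ge0}\frac{(a)_k(b)_k}{(c)_k}\frac{z^k}{k!}$ and $(x)_{k}=x(x+1)\cdots(x+k-1)$, $(x)_0=1$. The $r$-Stirling numbers of the second kind are defined by $\frac{(e^{t}-1)^{k}e^{pt}}{k!}=\sum_{m\geq k}\left\{{m+p\atop k+p}\right\}_{p}\frac{t^{m}}{m!}$ (zero for $k>m$); the $r$-Stirling numbers of the first kind by $(x+r)(x+r+1)\cdots(x+r+p-1)=\sum_{k=0}^{p}\left[{p+r\atop k+r}\right]_{r}x^{k}$. *)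

theory Defs
  imports "HOL-Computational_Algebra.Computational_Algebra" Complex_Main
begin

text \<open>
  All generating functions are formal power series over the reals. The composition is the
  usual one because \<open>1 - fps_exp 1\<close> has constant coefficient \<open>0\<close>, and
  \<open>fps_hypergeo [1, 1] [c] 1\<close> is \<open>2F1(1, 1; c; X)\<close>.
\<close>

definition p_bernoulli :: "nat \<Rightarrow> nat \<Rightarrow> real" where
  "p_bernoulli n p =
     fact n * fps_nth (fps_hypergeo [1, 1] [real p + 2] 1 oo (1 - fps_exp 1)) n"

text \<open>
  The arguments are in the order lower index \<open>r\<close>, upper entry, lower entry, and the entries are
  the unshifted ones: \<open>r_stirling2 p (m + p) (k + p)\<close> is the coefficient at index \<open>m\<close> in the
  generating function with parameter \<open>k\<close>. Entries below \<open>r\<close>, which the generating functions do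
  not cover, give \<open>0\<close>.
\<close>

definition r_stirling2 :: "nat \<Rightarrow> nat \<Rightarrow> nat \<Rightarrow> real" where
  "r_stirling2 r n k =
     (if r \<le> n \<and> r \<le> k
      then fact (n - r) *
             fps_nth (fps_const (1 / fact (k - r)) * (fps_exp 1 - 1) ^ (k - r) * fps_exp (real r))
               (n - r)
      else 0)"

text \<open>
  \<open>pochhammer [:real r, 1:] p\<close> is the polynomial \<open>(x + r)(x + r + 1)\<dots>(x + r + p - 1)\<close> in \<open>x\<close>.
\<close>

definition r_stirling1 :: "nat \<Rightarrow> nat \<Rightarrow> nat \<Rightarrow> real" where
  "r_stirling1 r n k =
     (if r \<le> n \<and> r \<le> k then poly.coeff (pochhammer [:real r, 1:] (n - r)) (k - r) else 0)"

end

theory Submission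
  imports Defs
begin

text \<open>
  The function \<open>z \<mapsto> 2F1(1, 1; p + 2; z)\<close> satisfies a contiguity relation which, in the variable
  \<open>z = 1 - e\<^sup>t\<close>, reads \<open>B\<^bsub>n+1,p\<^esub> = p B\<^bsub>n,p\<^esub> - (p+1)\<^sup>2/(p+2) B\<^bsub>n,p+1\<^esub>\<close>. After rescaling \<open>B\<^bsub>n,p+k\<^esub>\<close> to
  \<open>D n k\<close> this becomes \<open>D (n+1) k = (p+k) D n k + D n (k+1)\<close>. Hence the shift \<open>E\<close> in \<open>n\<close> gives
  \<open>D n k = (E - p)(E - p - 1)\<dots>(E - p - k + 1) D n 0\<close>. Expanding this product in powers of \<open>E\<close>
  produces the numbers of the first kind; inverting it produces those of the second kind.
\<close>

lemma hypergeo_11_nth: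
  "fps_nth (fps_hypergeo [1, 1] [real p + 2] 1) k = fact k / pochhammer (real p + 2) k"
  by (simp add: pochhammer_fact [symmetric])

text \<open>The factor \<open>fps_X - 1\<close> is \<open>z'\<close> written in terms of
  \<open>z = 1 - e^t\<close>, so the left side becomes a \<open>t\<close>-derivative after
  composition. All coefficients involved are rational multiples of
  \<open>a = k!/(p+2)_k\<close>.\<close>

lemma hypergeo_11_contiguous:
  "(fps_X - 1) * fps_deriv (fps_hypergeo [1, 1] [real p + 2] 1) =
     fps_const (real p) * fps_hypergeo [1, 1] [real p + 2] 1
     - fps_const ((real p + 1)\<^sup>2 / (real p + 2)) * fps_hypergeo [1, 1] [real (Suc p) + 2] 1"
    (is "_ = ?rhs")
proof (rule fps_ext)
  fix k
  define g where "g = fps_hypergeo [1, 1] [real p + 2] 1"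
  define a where "a = fact k / pochhammer (real p + 2) k"
  have pos: "real p + 2 + real k > 0" by simp
  have g_k: "fps_nth g k = a"
    unfolding g_def a_def by (rule hypergeo_11_nth)
  have g_Suc: "fps_nth g (Suc k) = a * (real k + 1) / (real p + 2 + real k)"
    unfolding g_def a_def hypergeo_11_nth by (simp add: pochhammer_rec' field_simps)
  \<comment> \<open>Both sides are \<open>(p+2)_(k+1)\<close>, with the last or the first factor
    split off.\<close>
  have "pochhammer (real p + 2) k * (real p + 2 + real k)
      = (real p + 2) * pochhammer (real (Suc p) + 2) k"
    using pochhammer_rec [of "real p + 2" k] pochhammer_rec' [of "real p + 2" k]
    by (simp add: algebra_simps)
  moreover have "pochhammer (real p + 2) k > 0" "pochhammer (real (Suc p) + 2) k > 0"
    by (auto intro!: pochhammer_pos)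
  ultimately have h_k: "fps_nth (fps_hypergeo [1, 1] [real (Suc p) + 2] 1) k
      = a * (real p + 2) / (real p + 2 + real k)"
    unfolding hypergeo_11_nth a_def using pos by (simp add: frac_eq_eq del: of_nat_Suc)
  have "fps_nth ((fps_X - 1) * fps_deriv g) k = real k * a - (real k + 1) * fps_nth g (Suc k)"
    by (cases k) (simp_all add: algebra_simps g_k [symmetric])
  also have "\<dots> = real p * a - (real p + 1)\<^sup>2 / (real p + 2) * (a * (real p + 2) / (real p + 2 + real k))"
  proof -
    \<comment> \<open>At heart this is \<open>(k+1)^2 - (p+1)^2 = (k-p)(k+p+2)\<close>, where
      \<open>c = k+p+2\<close>.\<close>
    have alg: "real k * a - (real k + 1) * (a * (real k + 1) / c) = real p * a - (real p + 1)\<^sup>2 / d * (a * d / c)"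
      if "c = d + real k" "d = real p + 2" for c d
    proof -
      have "c > 0" "d > 0" using that by simp_all
      then show ?thesis by (simp add: field_simps) (simp add: that algebra_simps power2_eq_square)
    qed
    show ?thesis unfolding g_Suc by (rule alg) simp_all
  qed
  also have "\<dots> = fps_nth ?rhs k"
    by (simp del: fps_hypergeo_nth of_nat_Suc add: h_k g_k [unfolded g_def])
  finally show "fps_nth ((fps_X - 1) * fps_deriv (fps_hypergeo [1, 1] [real p + 2] 1)) k = fps_nth ?rhs k"
    unfolding g_def .
qed

lemma p_bernoulli_Suc:
  "p_bernoulli (Suc n) p =
     real p * p_bernoulli n p - (real p + 1)\<^sup>2 / (real p + 2) * p_bernoulli n (Suc p)"
proof -
  define z :: "real fps" where "z = 1 - fps_exp 1"
  define G where "G q = fps_hypergeo [1, 1] [real q + 2] 1" for q :: nat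
  have z0: "fps_nth z 0 = 0" by (simp add: z_def)
  have "fps_deriv (G p oo z) = (fps_deriv (G p) oo z) * fps_deriv z"
    by (rule fps_compose_deriv [OF z0])
  \<comment> \<open>Since \<open>-e^t = z - 1\<close>, the chain rule factor is itself a composite
    with \<open>z\<close>.\<close>
  also have "fps_deriv z = (fps_X - 1) oo z"
    by (simp add: fps_compose_sub_distrib z0 z_def)
  also have "(fps_deriv (G p) oo z) * ((fps_X - 1) oo z) = ((fps_X - 1) * fps_deriv (G p)) oo z"
    by (simp add: fps_compose_mult_distrib [OF z0])
  also have "\<dots> = fps_const (real p) * (G p oo z)
      - fps_const ((real p + 1)\<^sup>2 / (real p + 2)) * (G (Suc p) oo z)"
    unfolding G_def hypergeo_11_contiguous
    by (simp only: fps_compose_sub_distrib fps_compose_mult_distrib [OF z0] fps_const_compose)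
  finally have "fps_nth (fps_deriv (G p oo z)) n = real p * fps_nth (G p oo z) n
      - (real p + 1)\<^sup>2 / (real p + 2) * fps_nth (G (Suc p) oo z) n"
    by simp
  then have "fact n * fps_nth (fps_deriv (G p oo z)) n = fact n * (real p * fps_nth (G p oo z) n
      - (real p + 1)\<^sup>2 / (real p + 2) * fps_nth (G (Suc p) oo z) n)"
    by simp
  then show ?thesis
    unfolding p_bernoulli_def G_def [symmetric] z_def [symmetric]
    by (simp add: algebra_simps)
qed

text \<open>Differentiate \<open>S k = (e^t - 1)^k e^(rt) / k!\<close>. The exponential contributes
  \<open>r S k\<close>; the power, after writing \<open>e^t = (e^t - 1) + 1\<close>, contributes
  \<open>k S k + S (k-1)\<close>.\<close>

lemma r_stirling2_recurrence:
  "r_stirling2 r (Suc m + r) (k + r) =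
     (real r + real k) * r_stirling2 r (m + r) (k + r)
     + (if k = 0 then 0 else r_stirling2 r (m + r) (k - 1 + r))"
proof -
  define S where "S k = fps_const (1 / fact k) * (fps_exp 1 - 1) ^ k * fps_exp (real r)" for k
  have val: "r_stirling2 r (i + r) (j + r) = fact i * fps_nth (S j) i" for i j
    by (simp add: r_stirling2_def S_def)
  have "fps_deriv (S k) = fps_const (real r + real k) * S k + (if k = 0 then 0 else S (k - 1))"
  proof (cases k)
    case 0
    then show ?thesis by (simp add: S_def)
  next
    case (Suc j)
    \<comment> \<open>With the common factor \<open>1/(j+1)!\<close> the derivative formula becomes
      a pure ring identity.\<close>
    have "fps_const (1 / fact j :: real) = fps_const (1 / fact (Suc j)) * fps_const (real (Suc j))"
      by (simp del: of_nat_Suc add: fps_const_mult)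
    then have S_j: "S j = fps_const (1 / fact (Suc j)) * fps_const (real (Suc j))
        * (fps_exp 1 - 1) ^ j * fps_exp (real r)"
      by (simp only: S_def)
    have "fps_deriv ((fps_exp 1 - 1 :: real fps) ^ Suc j)
        = fps_const (real (Suc j)) * fps_exp 1 * (fps_exp 1 - 1) ^ j"
      by (subst fps_deriv_power) (simp del: of_nat_Suc)
    then have "fps_deriv (S (Suc j)) = fps_const (1 / fact (Suc j)) *
        (fps_const (real (Suc j)) * fps_exp 1 * (fps_exp 1 - 1) ^ j * fps_exp (real r)
         + (fps_exp 1 - 1) ^ Suc j * (fps_const (real r) * fps_exp (real r)))"
      unfolding S_def
      by (simp add: algebra_simps del: of_nat_Suc power_Suc)
    also have "\<dots> = fps_const (real r + real (Suc j)) * S (Suc j) + S j"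
      unfolding S_j unfolding S_def fps_const_add [symmetric] by (simp only: power_Suc) algebra
    finally show ?thesis using Suc by simp
  qed
  then have "fps_nth (fps_deriv (S k)) m
      = (real r + real k) * fps_nth (S k) m + (if k = 0 then 0 else fps_nth (S (k - 1)) m)"
    by simp
  then have "fact m * fps_nth (fps_deriv (S k)) m
      = fact m * ((real r + real k) * fps_nth (S k) m + (if k = 0 then 0 else fps_nth (S (k - 1)) m))"
    by simp
  then show ?thesis
    unfolding val by (simp add: algebra_simps)
qed

lemma r_stirling2_0: "r_stirling2 r (0 + r) (k + r) = (if k = 0 then 1 else 0)"
  by (simp add: r_stirling2_def)

lemma r_stirling2_eq_0: "m < k \<Longrightarrow> r_stirling2 r (m + r) (k + r) = 0"
proof (induction m arbitrary: k)
  case 0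
  then show ?case by (simp only: r_stirling2_0) simp
next
  case (Suc m)
  then have "r_stirling2 r (m + r) (k + r) = 0" "r_stirling2 r (m + r) (k - 1 + r) = 0"
    by (simp, intro Suc.IH, simp)
  then show ?case by (simp only: r_stirling2_recurrence mult_zero_right if_cancel add_0)
qed

text \<open>A shift in \<open>n\<close> multiplies by \<open>r + k\<close> or raises
  \<open>k\<close> by one, which is how the numbers of the second kind are built. The induction uses
  its hypothesis at \<open>Suc n\<close>.\<close>

lemma r_stirling2_transform:
  fixes D :: "nat \<Rightarrow> nat \<Rightarrow> real"
  assumes D: "\<And>n k. D (Suc n) k = (real r + real k) * D n k + D n (Suc k)"
  shows "D (n + m) 0 = (\<Sum>k=0..m. r_stirling2 r (m + r) (k + r) * D n k)"
proof (induction m arbitrary: n)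
  case 0
  then show ?case using r_stirling2_0 [of r 0] by simp
next
  case (Suc m)
  let ?S = "\<lambda>m k. r_stirling2 r (m + r) (k + r)"
  have "D (n + Suc m) 0 = (\<Sum>k=0..m. ?S m k * D (Suc n) k)"
    using Suc.IH [of "Suc n"] by simp
  also have "\<dots> = (\<Sum>k=0..m. (real r + real k) * ?S m k * D n k) + (\<Sum>k=0..m. ?S m k * D n (Suc k))"
    by (simp add: D algebra_simps sum.distrib)
  \<comment> \<open>Both sums are extended to \<open>0..Suc m\<close>: this one by a vanishing entry
    with \<open>k > m\<close>, the next by re-indexing with a zero term at
    \<open>k = 0\<close>.\<close>
  also have "(\<Sum>k=0..m. (real r + real k) * ?S m k * D n k)
      = (\<Sum>k=0..Suc m. (real r + real k) * ?S m k * D n k)"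
    using r_stirling2_eq_0 [of m "Suc m" r] by simp
  also have "(\<Sum>k=0..m. ?S m k * D n (Suc k))
      = (\<Sum>k=0..Suc m. (if k = 0 then 0 else ?S m (k - 1)) * D n k)"
    by (subst sum.atLeast0_atMost_Suc_shift) simp
  finally show ?case
    unfolding r_stirling2_recurrence by (simp only: distrib_right sum.distrib)
qed

text \<open>The rising product gains the factor \<open>x + r + p\<close>; compare
  coefficients.\<close>

lemma r_stirling1_recurrence:
  "r_stirling1 r (Suc p + r) (k + r) =
     (real r + real p) * r_stirling1 r (p + r) (k + r)
     + (if k = 0 then 0 else r_stirling1 r (p + r) (k - 1 + r))"
proof -
  have "pochhammer [:real r, 1:] (Suc p) = pochhammer [:real r, 1:] p * [:real r + real p, 1:]"
    by (simp add: pochhammer_Suc of_nat_poly)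
  then show ?thesis
    by (simp add: r_stirling1_def coeff_pCons split: nat.split)
qed

lemma r_stirling1_0: "r_stirling1 r (0 + r) (k + r) = (if k = 0 then 1 else 0)"
  by (simp add: r_stirling1_def)

lemma r_stirling1_eq_0: "p < k \<Longrightarrow> r_stirling1 r (p + r) (k + r) = 0"
proof (induction p arbitrary: k)
  case 0
  then show ?case by (simp only: r_stirling1_0) simp
next
  case (Suc p)
  then have "r_stirling1 r (p + r) (k + r) = 0" "r_stirling1 r (p + r) (k - 1 + r) = 0"
    by (simp, intro Suc.IH, simp)
  then show ?case by (simp only: r_stirling1_recurrence mult_zero_right if_cancel add_0)
qed

text \<open>Put \<open>x = -E\<close> in the rising product \<open>(x+r)...(x+r+p-1)\<close>, with
  \<open>E\<close> the shift in \<open>n\<close>: this gives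
  \<open>(-1)^p (E-r)...(E-r-p+1)\<close>, hence both signs.\<close>

lemma r_stirling1_transform:
  fixes D :: "nat \<Rightarrow> nat \<Rightarrow> real"
  assumes D: "\<And>n k. D (Suc n) k = (real r + real k) * D n k + D n (Suc k)"
  shows "(-1) ^ p * D n p = (\<Sum>k=0..p. r_stirling1 r (p + r) (k + r) * (-1) ^ k * D (n + k) 0)"
proof (induction p arbitrary: n)
  case 0
  then show ?case using r_stirling1_0 [of r 0] by simp
next
  case (Suc p)
  let ?s = "\<lambda>p k. r_stirling1 r (p + r) (k + r)"
  let ?e = "\<lambda>k. (-1) ^ k * D (n + k) 0"
  have "(-1) ^ Suc p * D n (Suc p)
      = (real r + real p) * ((-1) ^ p * D n p) - (-1) ^ p * D (Suc n) p"
    by (simp add: D algebra_simps)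
  also have "\<dots> = (\<Sum>k=0..p. (real r + real p) * ?s p k * ?e k) + (\<Sum>k=0..p. ?s p k * ?e (Suc k))"
    unfolding Suc.IH by (simp add: sum_distrib_left sum_negf mult_ac)
  also have "(\<Sum>k=0..p. (real r + real p) * ?s p k * ?e k)
      = (\<Sum>k=0..Suc p. (real r + real p) * ?s p k * ?e k)"
    using r_stirling1_eq_0 [of p "Suc p" r] by simp
  also have "(\<Sum>k=0..p. ?s p k * ?e (Suc k))
      = (\<Sum>k=0..Suc p. (if k = 0 then 0 else ?s p (k - 1)) * ?e k)"
    by (subst sum.atLeast0_atMost_Suc_shift) simp
  finally show ?case
    unfolding r_stirling1_recurrence by (simp only: distrib_right sum.distrib mult.assoc)
qed

text \<open>Consecutive scaling factors have ratio \<open>-(q+1)^2/(q+2)\<close> with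
  \<open>q = p + k\<close>, the coefficient in \<open>p_bernoulli_Suc\<close>; this normalises it to
  \<open>1\<close>. At \<open>k = 0\<close> the factor is \<open>1/(p+1)\<close>.\<close>

definition scaled_p_bernoulli :: "nat \<Rightarrow> nat \<Rightarrow> nat \<Rightarrow> real" where
  "scaled_p_bernoulli p n k =
     (-1) ^ k * pochhammer (real p + 1) k / (real k + real p + 1) * p_bernoulli n (p + k)"

lemma scaled_p_bernoulli_Suc:
  "scaled_p_bernoulli p (Suc n) k =
     (real p + real k) * scaled_p_bernoulli p n k + scaled_p_bernoulli p n (Suc k)"
proof -
  have "real k + real p + 1 > 0" "real k + real p + 2 > 0" by simp_all
  then show ?thesis
    unfolding scaled_p_bernoulli_def p_bernoulli_Suc
    by (simp add: pochhammer_rec' divide_simps) (simp add: algebra_simps power2_eq_square)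
qed

theorem theorem3p10:
  shows "(\<forall>n p m :: nat.
            p_bernoulli (n + m) p =
              (real p + 1) *
              (\<Sum>k=0..m. r_stirling2 p (m + p) (k + p) *
                 ((-1) ^ k * pochhammer (real p + 1) k / (real k + real p + 1)) *
                 p_bernoulli n (p + k))) \<and>
         (\<forall>n r p :: nat. n \<ge> 1 \<longrightarrow> r \<ge> 1 \<longrightarrow>
            p_bernoulli n (p + r) =
              real r * (real p + real r + 1) / ((real r + 1) * pochhammer (real r) (p + 1)) *
              (\<Sum>k=0..p. r_stirling1 r (p + r) (k + r) * (-1) ^ k * p_bernoulli (n + k) r))"
proof (intro conjI allI impI)
  fix n p m :: nat
  have "p_bernoulli (n + m) p = (real p + 1) * scaled_p_bernoulli p (n + m) 0"
    by (simp add: scaled_p_bernoulli_def)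
  also have "\<dots> = (real p + 1) * (\<Sum>k=0..m. r_stirling2 p (m + p) (k + p) * scaled_p_bernoulli p n k)"
    using r_stirling2_transform [of "scaled_p_bernoulli p" p, OF scaled_p_bernoulli_Suc] by simp
  finally show "p_bernoulli (n + m) p =
      (real p + 1) *
      (\<Sum>k=0..m. r_stirling2 p (m + p) (k + p) *
         ((-1) ^ k * pochhammer (real p + 1) k / (real k + real p + 1)) *
         p_bernoulli n (p + k))"
    unfolding scaled_p_bernoulli_def by (simp only: mult.assoc)
next
  fix n r p :: nat
  assume "r \<ge> 1"
  let ?sum = "\<Sum>k=0..p. r_stirling1 r (p + r) (k + r) * (-1) ^ k * p_bernoulli (n + k) r"
  have "pochhammer (real r + 1) p * p_bernoulli n (p + r) / (real p + real r + 1)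
      = (-1) ^ p * scaled_p_bernoulli r n p"
    by (simp add: scaled_p_bernoulli_def add.commute flip: mult.assoc power_mult_distrib)
  also have "\<dots> = (\<Sum>k=0..p. r_stirling1 r (p + r) (k + r) * (-1) ^ k * scaled_p_bernoulli r (n + k) 0)"
    by (rule r_stirling1_transform [of "scaled_p_bernoulli r" r, OF scaled_p_bernoulli_Suc])
  also have "\<dots> = ?sum / (real r + 1)"
    by (simp add: scaled_p_bernoulli_def sum_divide_distrib)
  finally have eq: "pochhammer (real r + 1) p * p_bernoulli n (p + r) / (real p + real r + 1)
      = ?sum / (real r + 1)" .
  \<comment> \<open>Here \<open>c\<close> is \<open>r\<close>, which enters above and below because
    \<open>(r)_(p+1) = r (r+1)_p\<close>; \<open>P\<close> is \<open>(r+1)_p\<close>.\<close>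
  have solve: "x = c * a / (b * (c * P)) * y" if "P * x / a = y / b" "P > 0" "a > 0" "b > 0" "c > 0"
    for x y a b c P :: real
    using that by (simp add: field_simps)
  show "p_bernoulli n (p + r) =
      real r * (real p + real r + 1) / ((real r + 1) * pochhammer (real r) (p + 1)) * ?sum"
    unfolding Suc_eq_plus1 [symmetric] pochhammer_rec
    by (rule solve [OF eq]) (use \<open>r \<ge> 1\<close> in \<open>auto intro!: pochhammer_pos\<close>)
qed

end
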